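(* Let $X$ and $Y$ be finite $T_0$ topological spaces. If $F:X\multimap Y$ is a strongly upper semicontinuous (respectively, strongly lower semicontinuous) multivalued map such that $F(x)$ is acyclic for every $x\in X$, then $F$ is a Vietoris-like multivalued map.
   Context: A finite $T_0$ topological space is identified with a finite poset: $x\le y$ iff $U_x\subseteq U_y$, where $U_x$ is the intersection of all open sets containing $x$ (so the open sets are the lower sets); continuous maps are exactly the order-preserving maps. A space is acyclic if its (integral singular) homology groups are isomorphic to those of a point. A continuous map $f:X\to Y$ between finite $T_0$ spaces is a Vietoris-like map if for every chain $y_1<\dots<y_n$ in $Y$ ($n\ge1$) the subspace $\bigcup_{i=1}^n f^{-1}(y_i)$ of $X$ is acyclic. A multivalued map $F:X\multimap Y$ assigns to each $x\in X$ a subset $F(x)\subseteq Y$. It is strongly upper semicontinuous (susc) if $x_1\le x_2$ implies $F(x_1)\subseteq F(x_2)$, and strongly lower semicontinuous (slsc) if $x_1\ge x_2$ implies $F(x_1)\supseteq... $ reversed, namely $x_1\le x_2$ implies $F(x_1)\supseteq F(x_2)$. Its graph is $\Gamma(F)=\{(x,y)\in X\times Y : y\in F(x)\}$ with the order induced by the product order ($(x,y)\le(x',y')$ iff $x\le x'$ and $y\le y'$), and $p:\Gamma(F)\to X$ is the projection onto the first coordinate. $F$ is a Vietoris-like multivalued map if $p$ is a Vietoris-like map. *)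

theory Defs
  imports "HOL-Analysis.Analysis" "HOL-Homology.Homology"
begin

definition finite_T0_space :: "'a topology \<Rightarrow> bool" where
  "finite_T0_space X \<longleftrightarrow> finite (topspace X) \<and> t0_space X"

definition minimal_open :: "'a topology \<Rightarrow> 'a \<Rightarrow> 'a set" where
  "minimal_open X x = \<Inter>{U. openin X U \<and> x \<in> U}"

text \<open>The partial order on the points of a finite T0 space; the open sets are the lower sets.\<close>

definition pt_le :: "'a topology \<Rightarrow> 'a \<Rightarrow> 'a \<Rightarrow> bool" where
  "pt_le X x y \<longleftrightarrow> x \<in> topspace X \<and> y \<in> topspace X \<and> minimal_open X x \<subseteq> minimal_open X y"

definition pt_less :: "'a topology \<Rightarrow> 'a \<Rightarrow> 'a \<Rightarrow> bool" where
  "pt_less X x y \<longleftrightarrow> pt_le X x y \<and> x \<noteq> y"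

definition lower_set_topology :: "'a set \<Rightarrow> ('a \<Rightarrow> 'a \<Rightarrow> bool) \<Rightarrow> 'a topology" where
  "lower_set_topology A r =
     topology (\<lambda>U. U \<subseteq> A \<and> (\<forall>v\<in>U. \<forall>u\<in>A. r u v \<longrightarrow> u \<in> U))"

text \<open>The empty space is not acyclic, since its homology vanishes also in degree 0.\<close>

definition acyclic_space :: "'a topology \<Rightarrow> bool" where
  "acyclic_space X \<longleftrightarrow> (\<forall>p. homology_group p X \<cong> homology_group p (discrete_topology {()}))"

definition vietoris_like_map :: "'a topology \<Rightarrow> 'b topology \<Rightarrow> ('a \<Rightarrow> 'b) \<Rightarrow> bool" where
  "vietoris_like_map X Y f \<longleftrightarrow>
     finite_T0_space X \<and> finite_T0_space Y \<and> continuous_map X Y f \<and>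
     (\<forall>ys. ys \<noteq> [] \<and> set ys \<subseteq> topspace Y \<and> sorted_wrt (pt_less Y) ys \<longrightarrow>
        acyclic_space (subtopology X (\<Union>y\<in>set ys. {x \<in> topspace X. f x = y})))"

definition multivalued_map :: "'a topology \<Rightarrow> 'b topology \<Rightarrow> ('a \<Rightarrow> 'b set) \<Rightarrow> bool" where
  "multivalued_map X Y F \<longleftrightarrow> (\<forall>x\<in>topspace X. F x \<subseteq> topspace Y)"

definition strongly_usc :: "'a topology \<Rightarrow> ('a \<Rightarrow> 'b set) \<Rightarrow> bool" where
  "strongly_usc X F \<longleftrightarrow> (\<forall>x1 x2. pt_le X x1 x2 \<longrightarrow> F x1 \<subseteq> F x2)"

definition strongly_lsc :: "'a topology \<Rightarrow> ('a \<Rightarrow> 'b set) \<Rightarrow> bool" where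
  "strongly_lsc X F \<longleftrightarrow> (\<forall>x1 x2. pt_le X x1 x2 \<longrightarrow> F x2 \<subseteq> F x1)"

definition graph_set :: "'a topology \<Rightarrow> 'b topology \<Rightarrow> ('a \<Rightarrow> 'b set) \<Rightarrow> ('a \<times> 'b) set" where
  "graph_set X Y F = {(x, y). x \<in> topspace X \<and> y \<in> topspace Y \<and> y \<in> F x}"

definition graph_space :: "'a topology \<Rightarrow> 'b topology \<Rightarrow> ('a \<Rightarrow> 'b set) \<Rightarrow> ('a \<times> 'b) topology" where
  "graph_space X Y F =
     lower_set_topology (graph_set X Y F)
       (\<lambda>(x, y) (x', y'). pt_le X x x' \<and> pt_le Y y y')"

definition vietoris_like_multimap :: "'a topology \<Rightarrow> 'b topology \<Rightarrow> ('a \<Rightarrow> 'b set) \<Rightarrow> bool" where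
  "vietoris_like_multimap X Y F \<longleftrightarrow>
     multivalued_map X Y F \<and> vietoris_like_map (graph_space X Y F) X fst"

lemma openin_lower_set_topology:
  "openin (lower_set_topology A r) U \<longleftrightarrow>
     U \<subseteq> A \<and> (\<forall>v\<in>U. \<forall>u\<in>A. r u v \<longrightarrow> u \<in> U)"
proof -
  have "istopology (\<lambda>U. U \<subseteq> A \<and> (\<forall>v\<in>U. \<forall>u\<in>A. r u v \<longrightarrow> u \<in> U))"
    unfolding istopology_def by blast
  then show ?thesis
    by (simp add: lower_set_topology_def)
qed

lemma topspace_lower_set_topology: "topspace (lower_set_topology A r) = A"
  unfolding topspace_def by (auto simp: openin_lower_set_topology)

lemma openin_minimal_open:
  assumes "finite (topspace X)" and "x \<in> topspace X"
  shows "openin X (minimal_open X x)"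
proof -
  have "{U. openin X U \<and> x \<in> U} \<subseteq> Pow (topspace X)"
    using openin_subset by auto
  then have "finite {U. openin X U \<and> x \<in> U}"
    using assms(1) by (meson finite_Pow_iff finite_subset)
  moreover have "{U. openin X U \<and> x \<in> U} \<noteq> {}"
    using assms(2) by blast
  ultimately show ?thesis
    unfolding minimal_open_def by (intro openin_Inter) auto
qed

lemma minimal_open_subset_iff:
  assumes "finite (topspace X)" and "y \<in> topspace X"
  shows "minimal_open X x \<subseteq> minimal_open X y \<longleftrightarrow> x \<in> minimal_open X y"
  using openin_minimal_open[OF assms] unfolding minimal_open_def by blast

lemma finite_space_eq_lower_set_topology:
  assumes "finite (topspace X)"
  shows "X = lower_set_topology (topspace X) (pt_le X)"
proof (rule topology_eq[THEN iffD2], intro allI iffI)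
  fix U assume U: "openin X U"
  have "u \<in> U" if "v \<in> U" "pt_le X u v" for u v
    using that U unfolding pt_le_def minimal_open_def by blast
  then show "openin (lower_set_topology (topspace X) (pt_le X)) U"
    using openin_subset[OF U] by (auto simp: openin_lower_set_topology)
next
  fix U assume U: "openin (lower_set_topology (topspace X) (pt_le X)) U"
  have "\<exists>T. openin X T \<and> v \<in> T \<and> T \<subseteq> U" if v: "v \<in> U" for v
  proof (intro exI conjI)
    have vX: "v \<in> topspace X"
      using U v by (auto simp: openin_lower_set_topology)
    show o: "openin X (minimal_open X v)"
      by (rule openin_minimal_open[OF assms vX])
    show "v \<in> minimal_open X v"
      by (auto simp: minimal_open_def)
    show "minimal_open X v \<subseteq> U"
      using U v vX openin_subset[OF o] minimal_open_subset_iff[OF assms vX]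
      by (auto simp: openin_lower_set_topology pt_le_def)
  qed
  then show "openin X U"
    using openin_subopen by blast
qed

text \<open>The order-theoretic topology on the graph is the usual subspace topology.\<close>

lemma graph_space_eq_subtopology:
  assumes "finite (topspace X)" and "finite (topspace Y)"
  shows "graph_space X Y F = subtopology (prod_topology X Y) (graph_set X Y F)"
proof (rule topology_eq[THEN iffD2], intro allI iffI)
  fix U assume "openin (graph_space X Y F) U"
  then have sub: "U \<subseteq> graph_set X Y F"
    and low: "\<And>x y x' y'. \<lbrakk>(x', y') \<in> U; (x, y) \<in> graph_set X Y F; pt_le X x x'; pt_le Y y y'\<rbrakk>
                \<Longrightarrow> (x, y) \<in> U"
    unfolding graph_space_def openin_lower_set_topology by fastforce+
  let ?T = "\<Union>(x, y)\<in>U. minimal_open X x \<times> minimal_open Y y"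
  have pts: "x \<in> topspace X" "y \<in> topspace Y" if "(x, y) \<in> U" for x y
    using sub that by (auto simp: graph_set_def)
  have "openin (prod_topology X Y) ?T"
    using assms pts by (intro openin_Union) (auto simp: openin_prod_Times_iff openin_minimal_open)
  moreover have "U = ?T \<inter> graph_set X Y F"
  proof (intro subset_antisym subsetI)
    fix z assume z: "z \<in> U"
    obtain x y where xy: "z = (x, y)" by (cases z)
    have "x \<in> minimal_open X x" "y \<in> minimal_open Y y"
      by (auto simp: minimal_open_def)
    then have "z \<in> ?T"
      using z xy by blast
    then show "z \<in> ?T \<inter> graph_set X Y F"
      using sub z by blast
  next
    fix z assume "z \<in> ?T \<inter> graph_set X Y F"
    then obtain a b x y where z: "z = (a, b)" "z \<in> graph_set X Y F" "(x, y) \<in> U"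
      "a \<in> minimal_open X x" "b \<in> minimal_open Y y" by auto
    moreover have "pt_le X a x" "pt_le Y b y"
      using z pts[OF z(3)] assms by (auto simp: pt_le_def graph_set_def minimal_open_subset_iff)
    ultimately show "z \<in> U"
      using low by blast
  qed
  ultimately show "openin (subtopology (prod_topology X Y) (graph_set X Y F)) U"
    unfolding openin_subtopology by blast
next
  fix U assume "openin (subtopology (prod_topology X Y) (graph_set X Y F)) U"
  then obtain T where T: "openin (prod_topology X Y) T" "U = T \<inter> graph_set X Y F"
    by (auto simp: openin_subtopology)
  have low: "(a, b) \<in> T" if "(x, y) \<in> T" "pt_le X a x" "pt_le Y b y" for a b x y
  proof -
    have "\<forall>x y. (x, y) \<in> T \<longrightarrow>
        (\<exists>V W. openin X V \<and> openin Y W \<and> x \<in> V \<and> y \<in> W \<and> V \<times> W \<subseteq> T)"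
      using T(1) by (simp only: openin_prod_topology_alt)
    then obtain V W where VW: "openin X V" "openin Y W" "x \<in> V" "y \<in> W" "V \<times> W \<subseteq> T"
      using \<open>(x, y) \<in> T\<close> by meson
    have "minimal_open X x \<subseteq> V" "minimal_open Y y \<subseteq> W"
      using VW by (auto simp: minimal_open_def)
    moreover have "a \<in> minimal_open X a" "b \<in> minimal_open Y b"
      by (auto simp: minimal_open_def)
    ultimately have "a \<in> V" "b \<in> W"
      using that unfolding pt_le_def by blast+
    then show ?thesis using VW(5) by blast
  qed
  then show "openin (graph_space X Y F) U"
    by (auto simp: graph_space_def openin_lower_set_topology T(2) intro: low)
qed

end

theory Submission
  imports Defs
begin

text \<open>
  Let \<open>C\<close> be a nonempty finite chain in \<open>X\<close>, and let \<open>E\<close> be the part of the graph of \<open>F\<close> that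
  lies over \<open>C\<close>. If \<open>F\<close> is strongly upper semicontinuous, the largest element \<open>a\<close> of \<open>C\<close> has the
  largest value: \<open>F x \<subseteq> F a\<close> for all \<open>x \<in> C\<close>. Hence the retraction
  \<open>(x, y) \<mapsto> (a, y)\<close> of \<open>E\<close> onto the fibre over \<open>a\<close> is well defined, and it lies pointwise
  above the identity in the order of the graph. If \<open>F\<close> is strongly lower semicontinuous, the same
  holds with \<open>a\<close> the smallest element of \<open>C\<close>, and the retraction lies below the identity.

  Comparable continuous maps are homotopic (\<open>homotopic_with_if_specializes\<close>), so in both cases \<open>E\<close>
  is homotopy equivalent to \<open>F a\<close> (\<open>graph_over_homotopy_equivalent_value\<close>). Homology is a homotopy
  invariant and \<open>F a\<close> is acyclic, so \<open>E\<close> is acyclic.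
\<close>

text \<open>
  The homotopy stays at \<open>f\<close> for every time before \<open>1\<close> and jumps to \<open>g\<close> at time \<open>1\<close>. The jump is
  continuous because every open set containing \<open>g x\<close> already contains \<open>f x\<close>: the preimage of an
  open \<open>U\<close> is the union of \<open>[0,1) \<times> f\<^sup>-\<^sup>1(U)\<close> and \<open>[0,1] \<times> g\<^sup>-\<^sup>1(U)\<close>.
\<close>

lemma homotopic_with_if_specializes:
  assumes f: "continuous_map X Y f" and g: "continuous_map X Y g"
    and spec: "\<And>x U. \<lbrakk>x \<in> topspace X; openin Y U; g x \<in> U\<rbrakk> \<Longrightarrow> f x \<in> U"
  shows "homotopic_with (\<lambda>_. True) X Y f g"
proof -
  define h where "h = (\<lambda>(t::real, x). if t < 1 then f x else g x)"
  let ?I = "top_of_set {0..1::real}"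
  have "continuous_map (prod_topology ?I X) Y h"
    unfolding continuous_map_def
  proof (intro conjI allI impI)
    show "h \<in> topspace (prod_topology ?I X) \<rightarrow> topspace Y"
      using f g by (auto simp: h_def continuous_map_def)
  next
    fix U assume U: "openin Y U"
    let ?f = "{x \<in> topspace X. f x \<in> U}" and ?g = "{x \<in> topspace X. g x \<in> U}"
    have "{z \<in> topspace (prod_topology ?I X). h z \<in> U} = {0..<1} \<times> ?f \<union> {0..1} \<times> ?g"
      using spec[OF _ U] by (auto simp: h_def split: if_splits)
    moreover have "{0..<1} = {0..1} \<inter> {..<1::real}"
      by auto
    then have "openin ?I {0..<1::real}"
      by (simp add: openin_open_Int)
    moreover have "openin X ?f" "openin X ?g"
      using U f g by (auto simp: continuous_map_def)
    ultimately show "openin (prod_topology ?I X) {z \<in> topspace (prod_topology ?I X). h z \<in> U}"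
      by (auto intro!: openin_Un simp: openin_prod_Times_iff)
  qed
  then show ?thesis
    unfolding homotopic_with_def by (intro exI[of _ h]) (auto simp: h_def)
qed

lemma acyclic_space_homotopy_equivalent:
  assumes "X homotopy_equivalent_space Y" and "acyclic_space Y"
  shows "acyclic_space X"
  using homotopy_equivalent_space_imp_isomorphic_homology_groups[OF assms(1)] assms(2)
  unfolding acyclic_space_def by (blast intro: iso_trans)

lemma topspace_graph_space: "topspace (graph_space X Y F) = graph_set X Y F"
  by (simp add: graph_space_def topspace_lower_set_topology)

lemma openin_graph_space_downward:
  assumes "openin (graph_space X Y F) U" and "(x', y') \<in> U"
    and "(x, y) \<in> graph_set X Y F" and "pt_le X x x'" and "pt_le Y y y'"
  shows "(x, y) \<in> U"
  using assms unfolding graph_space_def openin_lower_set_topology by fastforce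

lemma finite_T0_space_graph_space:
  assumes "finite_T0_space X" and "finite_T0_space Y"
  shows "finite_T0_space (graph_space X Y F)"
proof -
  have fin: "finite (topspace X)" "finite (topspace Y)"
    using assms by (auto simp: finite_T0_space_def)
  have "graph_set X Y F \<subseteq> topspace X \<times> topspace Y"
    by (auto simp: graph_set_def)
  then have "finite (graph_set X Y F)"
    using fin by (meson finite_SigmaI finite_subset)
  moreover have "t0_space (graph_space X Y F)"
    using assms unfolding graph_space_eq_subtopology[OF fin] finite_T0_space_def
    by (intro t0_space_subtopology) (simp add: t0_space_prod_topology_iff)
  ultimately show ?thesis
    by (simp add: finite_T0_space_def topspace_graph_space)
qed

lemma continuous_map_fst_graph_space:
  assumes "finite (topspace X)" and "finite (topspace Y)"
  shows "continuous_map (graph_space X Y F) X fst"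
  unfolding graph_space_eq_subtopology[OF assms]
  by (intro continuous_map_from_subtopology continuous_map_fst)

text \<open>
  The second projection and the section \<open>y \<mapsto> (a, y)\<close> are mutually inverse up to homotopy: one
  composite is the identity of \<open>F a\<close>, and the other one is \<open>(x, y) \<mapsto> (a, y)\<close>, which is comparable
  to the identity when \<open>a\<close> is an upper or a lower bound of \<open>C\<close>.
\<close>

lemma graph_over_homotopy_equivalent_value:
  assumes fin: "finite (topspace X)" "finite (topspace Y)"
    and C: "C \<subseteq> topspace X" and a: "a \<in> C"
    and Fa: "\<And>x. x \<in> C \<Longrightarrow> F x \<subseteq> F a"
    and bound: "(\<forall>x\<in>C. pt_le X x a) \<or> (\<forall>x\<in>C. pt_le X a x)"
  shows "subtopology (graph_space X Y F) {z \<in> graph_set X Y F. fst z \<in> C}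
           homotopy_equivalent_space subtopology Y (F a)"
proof -
  let ?S = "{z \<in> graph_set X Y F. fst z \<in> C}"
  define E where "E = subtopology (graph_space X Y F) ?S"
  have E: "E = subtopology (prod_topology X Y) ?S"
    unfolding E_def graph_space_eq_subtopology[OF fin] subtopology_subtopology
    by (rule arg_cong[where f = "subtopology _"]) auto
  have topE: "topspace E = ?S"
    by (auto simp: E_def topspace_graph_space)
  have snd: "continuous_map E (subtopology Y (F a)) snd"
    unfolding continuous_map_in_subtopology
  proof
    show "continuous_map E Y snd"
      unfolding E by (intro continuous_map_from_subtopology continuous_map_snd)
    show "snd \<in> topspace E \<rightarrow> F a"
      using Fa unfolding topE graph_set_def by fastforce
  qed
  have sec: "continuous_map (subtopology Y (F a)) E (Pair a)"
    unfolding E continuous_map_in_subtopology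
  proof
    show "continuous_map (subtopology Y (F a)) (prod_topology X Y) (Pair a)"
      using a C by (auto simp: continuous_map_pairwise o_def continuous_map_from_subtopology)
    show "Pair a \<in> topspace (subtopology Y (F a)) \<rightarrow> ?S"
      using a C by (auto simp: graph_set_def)
  qed
  have retr: "continuous_map E E (Pair a \<circ> snd)"
    using snd sec by (rule continuous_map_compose)
  have down: "(x, y) \<in> U"
    if U: "openin E U" and "(x', y) \<in> U" "(x, y) \<in> ?S" "pt_le X x x'" for x x' y U
  proof -
    obtain V where V: "openin (graph_space X Y F) V" "U = V \<inter> ?S"
      using U[unfolded E_def openin_subtopology] by (elim exE conjE)
    have "pt_le Y y y"
      using that(3) by (simp add: pt_le_def graph_set_def)
    moreover have "(x', y) \<in> V" "(x, y) \<in> graph_set X Y F"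
      using V(2) that(2,3) by simp_all
    ultimately have "(x, y) \<in> V"
      using openin_graph_space_downward[OF V(1)] that(4) by blast
    then show ?thesis
      using V(2) that(3) by simp
  qed
  have pts: "(a, y) \<in> ?S" if "(x, y) \<in> ?S" for x y
    using that a C Fa[of x] by (auto simp: graph_set_def)
  have "homotopic_with (\<lambda>_. True) E E (Pair a \<circ> snd) id"
    using bound
  proof
    assume le: "\<forall>x\<in>C. pt_le X x a"
    have "homotopic_with (\<lambda>_. True) E E id (Pair a \<circ> snd)"
    proof (rule homotopic_with_if_specializes[OF continuous_map_id retr])
      fix z U assume "z \<in> topspace E" "openin E U" "(Pair a \<circ> snd) z \<in> U"
      then show "id z \<in> U"
        using le down[of U a "snd z" "fst z"] by (simp add: topE)
    qed
    then show ?thesis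
      by (rule homotopic_with_sym[THEN iffD1])
  next
    assume le: "\<forall>x\<in>C. pt_le X a x"
    show ?thesis
    proof (rule homotopic_with_if_specializes[OF retr continuous_map_id])
      fix z U assume "z \<in> topspace E" "openin E U" "id z \<in> U"
      then show "(Pair a \<circ> snd) z \<in> U"
        using le down[of U "fst z" "snd z" a] pts[of "fst z" "snd z"] by (simp add: topE)
    qed
  qed
  moreover have "homotopic_with (\<lambda>_. True) (subtopology Y (F a)) (subtopology Y (F a))
               (snd \<circ> Pair a) id"
    by (simp add: o_def id_def)
  ultimately show ?thesis
    unfolding E_def[symmetric] homotopy_equivalent_space_def
    using snd sec by (intro exI[of _ snd] exI[of _ "Pair a"]) simp
qed

lemma sorted_wrt_pt_less_bounds:
  assumes "sorted_wrt (pt_less X) ys" and "set ys \<subseteq> topspace X" and "x \<in> set ys"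
  shows "pt_le X (hd ys) x" and "pt_le X x (last ys)"
proof -
  have refl: "pt_le X x x"
    using assms by (auto simp: pt_le_def)
  show "pt_le X (hd ys) x"
    using assms refl by (cases ys) (auto simp: pt_less_def)
  show "pt_le X x (last ys)"
    using assms refl by (cases ys rule: rev_cases) (auto simp: pt_less_def sorted_wrt_append)
qed

theorem proposition2p16:
  fixes X :: "'a topology" and Y :: "'b topology" and F :: "'a \<Rightarrow> 'b set"
  assumes "finite_T0_space X" and "finite_T0_space Y"
    and "multivalued_map X Y F"
    and "\<forall>x\<in>topspace X. acyclic_space (subtopology Y (F x))"
  shows "(strongly_usc X F \<longrightarrow> vietoris_like_multimap X Y F) \<and>
         (strongly_lsc X F \<longrightarrow> vietoris_like_multimap X Y F)"
proof -
  have fin: "finite (topspace X)" "finite (topspace Y)"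
    using assms by (auto simp: finite_T0_space_def)
  have "vietoris_like_multimap X Y F" if sc: "strongly_usc X F \<or> strongly_lsc X F"
  proof -
    have "acyclic_space (subtopology (graph_space X Y F)
            (\<Union>y\<in>set ys. {z \<in> topspace (graph_space X Y F). fst z = y}))"
      if ys: "ys \<noteq> []" "set ys \<subseteq> topspace X" "sorted_wrt (pt_less X) ys" for ys
    proof -
      note bounds = sorted_wrt_pt_less_bounds[OF ys(3,2)]
      obtain a where a: "a \<in> set ys" "\<And>x. x \<in> set ys \<Longrightarrow> F x \<subseteq> F a"
        "(\<forall>x\<in>set ys. pt_le X x a) \<or> (\<forall>x\<in>set ys. pt_le X a x)"
        using sc
      proof
        assume "strongly_usc X F"
        then show thesis
          using bounds(2) ys(1) by (intro that[of "last ys"]) (auto simp: strongly_usc_def)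
      next
        assume "strongly_lsc X F"
        then show thesis
          using bounds(1) ys(1) by (intro that[of "hd ys"]) (auto simp: strongly_lsc_def)
      qed
      have "(\<Union>y\<in>set ys. {z \<in> topspace (graph_space X Y F). fst z = y})
              = {z \<in> graph_set X Y F. fst z \<in> set ys}"
        by (auto simp: topspace_graph_space)
      moreover have "acyclic_space (subtopology Y (F a))"
        using assms(4) a(1) ys(2) by blast
      ultimately show ?thesis
        using graph_over_homotopy_equivalent_value[where F = F, OF fin ys(2) a]
          acyclic_space_homotopy_equivalent by metis
    qed
    then show ?thesis
      using assms(1-3) fin
      by (auto simp: vietoris_like_multimap_def vietoris_like_map_def
          finite_T0_space_graph_space continuous_map_fst_graph_space)
  qed
  then show ?thesis
    by blast
qed

end
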